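(* Let $\Omega_i=\mathbb R^p$ for all $i$. Suppose the graph $\mathcal G$ is connected, $\mathbf L=U^\top U$ satisfies the graph and null-space conditions given in the context, each $f_i:\mathbb R^p\to\mathbb R$ is differentiable with $L_i$-Lipschitz gradient and is $\mu_i$-strongly convex ($\mu_i>0$); put $\mu=\min_i\mu_i$, $L=\max_iL_i$. Suppose furthermore that $\lambda_{\max}(\mathbf L)\le1$ and $c\in(0,\frac1{2L})$. Then the sequence $\{\mathbf x^k\}$ generated by Mirror-EXTRA converges to the optimal solution $\mathbf x^*$ of the problem of minimizing $\sum_if_i(x_i)$ subject to $\sum_i(x_i-r_i)=0$ at an R-linear rate, $$\|\mathbf x^{k+1}-\mathbf x^*\|_{\mathrm F}^2=O\!\left(\frac1{(1+\delta)^k}\right),$$ where $\delta>0$ is such that, for some $\gamma>0$, $$\delta\le\min\left\{\frac{2\mu Lc\,\tilde\lambda_{\min}(\mathbf L)}{(\mu+L)(1+\gamma)},\ \frac{c^2L^2\tilde\lambda_{\min}(\mathbf L)}{1+\gamma+cL(2-3cL)\tilde\lambda_{\min}(\mathbf L)+2c^2L^2(1+\frac1\gamma)},\ \frac{(1-2cL)\tilde\lambda_{\min}(\mathbf L)}{cL(1+\frac1\gamma)}\right\}.$$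
   Context: Agents $i=1,\dots,n$ have $f_i:\mathbb R^p\to\mathbb R$ and $r_i\in\mathbb R^p$. Points are matrices $\mathbf x\in\mathbb R^{n\times p}$ with $i$-th row $x_i^\top$. A function $f$ is $\mu$-strongly convex if $\langle\nabla f(x)-\nabla f(y),x-y\rangle\ge\mu\|x-y\|_2^2$ for all $x,y$. $\lambda_{\max}$ is the largest eigenvalue and $\tilde\lambda_{\min}$ the smallest nonzero eigenvalue of a symmetric positive semidefinite matrix; $\|\cdot\|_{\mathrm F}$ is the Frobenius norm. Graph. $\mathcal G$ is a simple undirected graph on $\{1,\dots,n\}$ with edge set $\mathcal E$ and neighbor sets $\mathcal N_i$. The $n\times n$ matrix $\mathbf L=[L_{ij}]$ is compatible with $\mathcal G$ (that is, $L_{ij}=0$ whenever $i\ne j$ and $\{i,j\}\notin\mathcal E$) and $\mathbf L=U^\top U$ for some full-row-rank $U\in\mathbb R^{(n-1)\times n}$ with null space $\{a\mathbf 1: a\in\mathbb R\}$. Algorithm (Mirror-EXTRA). Each agent $i$ initializes with arbitrary $x_i^0\in\mathbb R^p$ and $y_i^{-1}=0$. For $k=0,1,\dots$: $y_i^k=y_i^{k-1}+\sum_{j\in\mathcal N_i\cup\{i\}}L_{ij}\nabla f_j(x_j^k)$; $x_i^{k+1}=r_i-2cy_i^k+cy_i^{k-1}$. *)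

theory Defs
  imports "HOL-Analysis.Analysis" "HOL-Library.Landau_Symbols"
begin

text \<open>
  A point of \<open>\<real>\<^sup>n\<^sup>\<times>\<^sup>p\<close> is an element \<open>x\<close> of \<open>real ^ 'p ^ 'n\<close>, and \<open>x $ i\<close> is its \<open>i\<close>-th row.
  The library norm of this type is the Frobenius norm:
\<close>

lemma norm_eq_frobenius:
  fixes A :: "real ^ 'p ^ 'n"
  shows "norm A = sqrt (\<Sum>i\<in>UNIV. \<Sum>j\<in>UNIV. (A $ i $ j)\<^sup>2)"
  by (simp add: norm_vec_def L2_set_def sum_nonneg)

text \<open>
  Meaningful only where \<open>f\<close> is differentiable; the gradient is then unique.
\<close>

definition gradient :: "('a::euclidean_space \<Rightarrow> real) \<Rightarrow> 'a \<Rightarrow> 'a" where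
  "gradient f x = (THE D. GDERIV f x :> D)"

definition strongly_convex :: "real \<Rightarrow> ('a::euclidean_space \<Rightarrow> real) \<Rightarrow> bool" where
  "strongly_convex \<mu> f \<longleftrightarrow>
     (\<forall>x y. (gradient f x - gradient f y) \<bullet> (x - y) \<ge> \<mu> * (norm (x - y))\<^sup>2)"

definition eigenvalues :: "real ^ 'n ^ 'n \<Rightarrow> real set" where
  "eigenvalues A = {t. \<exists>v. v \<noteq> 0 \<and> A *v v = t *s v}"

text \<open>
  Both are meant for symmetric positive semidefinite matrices, the second one for nonzero
  such matrices only (otherwise it is the minimum of the empty set).
\<close>

definition lambda_max :: "real ^ 'n ^ 'n \<Rightarrow> real" where
  "lambda_max A = Max (eigenvalues A)"

definition lambda_min_nonzero :: "real ^ 'n ^ 'n \<Rightarrow> real" where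
  "lambda_min_nonzero A = Min (eigenvalues A - {0})"

text \<open>
  A simple undirected graph on the vertex set \<open>UNIV :: 'n set\<close> is given by its edges, which are
  two-element sets of vertices.
\<close>

definition simple_graph :: "'n set set \<Rightarrow> bool" where
  "simple_graph E \<longleftrightarrow> (\<forall>e\<in>E. card e = 2)"

definition neighbors :: "'n set set \<Rightarrow> 'n \<Rightarrow> 'n set" where
  "neighbors E i = {j. {i, j} \<in> E}"

definition connected_graph :: "'n set set \<Rightarrow> bool" where
  "connected_graph E \<longleftrightarrow> (\<forall>i j. (i, j) \<in> {(a, b). {a, b} \<in> E}\<^sup>*)"

definition compatible :: "'n set set \<Rightarrow> real ^ 'n ^ 'n \<Rightarrow> bool" where
  "compatible E A \<longleftrightarrow> (\<forall>i j. i \<noteq> j \<and> {i, j} \<notin> E \<longrightarrow> A $ i $ j = 0)"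

text \<open>
  The second sequence starts at index \<open>-1\<close> in the algorithm, hence the index shift:
  \<open>y k\<close> stands for \<open>y\<^sup>k\<^sup>-\<^sup>1\<close>.
  The starting point \<open>x 0\<close> is arbitrary.
\<close>

definition mirror_extra ::
  "'n::finite set set \<Rightarrow> real ^ 'n ^ 'n \<Rightarrow> ('n \<Rightarrow> real ^ 'p \<Rightarrow> real) \<Rightarrow> real ^ 'p ^ 'n \<Rightarrow> real \<Rightarrow>
   (nat \<Rightarrow> real ^ 'p ^ 'n) \<Rightarrow> (nat \<Rightarrow> real ^ 'p ^ 'n) \<Rightarrow> bool" where
  "mirror_extra E A f r c x y \<longleftrightarrow>
     (\<forall>i. y 0 $ i = 0) \<and>
     (\<forall>k i. y (Suc k) $ i =
        y k $ i + (\<Sum>j \<in> neighbors E i \<union> {i}. A $ i $ j *\<^sub>R gradient (f j) (x k $ j))) \<and>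
     (\<forall>k i. x (Suc k) $ i = r $ i - (2 * c) *\<^sub>R (y (Suc k) $ i) + c *\<^sub>R (y k $ i))"

definition optimal_solution ::
  "('n::finite \<Rightarrow> real ^ 'p \<Rightarrow> real) \<Rightarrow> real ^ 'p ^ 'n \<Rightarrow> real ^ 'p ^ 'n \<Rightarrow> bool" where
  "optimal_solution f r =
     is_arg_min (\<lambda>x. \<Sum>i\<in>UNIV. f i (x $ i)) (\<lambda>x. (\<Sum>i\<in>UNIV. x $ i - r $ i) = 0)"

text \<open>
  The upper bound for the rate parameter; \<open>l\<close> is the smallest nonzero eigenvalue.
\<close>

definition rate_bound :: "real \<Rightarrow> real \<Rightarrow> real \<Rightarrow> real \<Rightarrow> real \<Rightarrow> real" where
  "rate_bound \<mu> L c l \<gamma> = Min {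
     2 * \<mu> * L * c * l / ((\<mu> + L) * (1 + \<gamma>)),
     c\<^sup>2 * L\<^sup>2 * l / (1 + \<gamma> + c * L * (2 - 3 * c * L) * l + 2 * c\<^sup>2 * L\<^sup>2 * (1 + 1 / \<gamma>)),
     (1 - 2 * c * L) * l / (c * L * (1 + 1 / \<gamma>))}"

end

theory Submission
  imports Defs
begin

text \<open>
  Mirror-EXTRA is a dual method. Write \<open>G x\<close> for the matrix of local gradients. The solution \<open>x\<^sup>*\<close> is
  characterized by consensus of the gradients, \<open>U G(x\<^sup>*) = 0\<close>, and by feasibility, which says that
  \<open>r - x\<^sup>* = c U\<^sup>T q\<^sup>*\<close> for some dual variable \<open>q\<^sup>*\<close>, since the range of \<open>U\<^sup>T\<close> is the orthogonal complement
  of the constants (\<open>optimal_solution_exists\<close>, \<open>zero_sum_in_range_transpose\<close>).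

  With \<open>u\<^sup>k = U G(x\<^sup>k)\<close> and \<open>q\<^sup>k = u\<^sup>0 + \<dots> + u\<^sup>k\<close> the algorithm becomes
  \<open>x\<^sup>k\<^sup>+\<^sup>1 = r - c U\<^sup>T q\<^sup>k\<^sup>+\<^sup>1 + c U\<^sup>T (u\<^sup>k\<^sup>+\<^sup>1 - u\<^sup>k)\<close>: an implicit dual step, disturbed by the difference of
  two consecutive gradients (\<open>mirror_extra_factored\<close>). Pairing the error of this equation with the
  gradient error gives an exact balance for \<open>\<bar>q\<^sup>k - q\<^sup>*\<bar>\<^sup>2\<close>. Three facts turn the balance into the
  contraction \<open>(1 + \<delta>) V\<^sup>k\<^sup>+\<^sup>1 \<le> V\<^sup>k\<close> of \<open>V\<^sup>k = \<bar>q\<^sup>k - q\<^sup>*\<bar>\<^sup>2 + (1 + 2 B) \<bar>u\<^sup>k\<bar>\<^sup>2\<close>, where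
  \<open>B = \<delta> (1 + 1/\<gamma>) / \<lambda>\<close> and \<open>\<lambda>\<close> is the smallest nonzero eigenvalue (\<open>lyapunov_step\<close>):

  \<^item> coercivity of gradients of smooth strongly convex functions in the sharp form
    \<open>(\<mu> + L) \<langle>G x - G z, x - z\<rangle> \<ge> \<bar>G x - G z\<bar>\<^sup>2 + \<mu> L \<bar>x - z\<bar>\<^sup>2\<close> (\<open>gradient_coercivity\<close>);
  \<^item> \<open>\<lambda> \<bar>q\<bar>\<^sup>2 \<le> \<bar>U\<^sup>T q\<bar>\<^sup>2\<close>, because the nonzero eigenvalues of \<open>U\<^sup>T U\<close> are those of \<open>U U\<^sup>T\<close>
    (\<open>lambda_min_nonzero_gram\<close>), which bounds the dual error by the primal one;
  \<^item> \<open>U\<close> and \<open>U\<^sup>T\<close> do not increase norms, because the eigenvalues of \<open>U\<^sup>T U\<close> are at most 1.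

  The three terms of the rate bound are the conditions under which this calculation closes. Finally
  \<open>\<bar>x\<^sup>k\<^sup>+\<^sup>1 - x\<^sup>*\<bar>\<^sup>2\<close> is at most a constant times \<open>V\<^sup>k\<close>, and the rate bound is positive for \<open>\<gamma> = 1\<close>, so the
  estimate is not vacuous and gives convergence.
\<close>

section \<open>Gradients of smooth strongly convex functions\<close>

lemma has_real_derivative_along_line:
  fixes f :: "'a::real_inner \<Rightarrow> real"
  assumes "GDERIV f (a + t *\<^sub>R v) :> d"
  shows "((\<lambda>s. f (a + s *\<^sub>R v)) has_real_derivative d \<bullet> v) (at t)"
proof -
  have "((\<lambda>s. a + s *\<^sub>R v) has_derivative (\<lambda>s. s *\<^sub>R v)) (at t)"
    by (auto intro!: derivative_eq_intros)
  from has_derivative_compose [OF this assms [unfolded gderiv_def]]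
  show ?thesis
    by (simp add: has_field_derivative_def inner_commute mult_commute_abs)
qed

text \<open>
  The growth condition says that \<open>f\<close> minus its quadratic model at \<open>a\<close> has nonpositive derivative
  along every ray from \<open>a\<close>. The constant \<open>K\<close> may have either sign, so that the mirror image of this
  lemma covers convex and strongly convex functions.
\<close>

lemma quadratic_upper_bound:
  fixes f :: "'a::real_inner \<Rightarrow> real"
  assumes grad: "\<And>z. GDERIV f z :> g z"
    and growth: "\<And>z. (g z - g a) \<bullet> (z - a) \<le> K * (norm (z - a))\<^sup>2"
  shows "f b \<le> f a + g a \<bullet> (b - a) + K / 2 * (norm (b - a))\<^sup>2"
proof -
  define v where "v = b - a"
  define \<phi> where "\<phi> t = f (a + t *\<^sub>R v) - t * (g a \<bullet> v) - K / 2 * t\<^sup>2 * (norm v)\<^sup>2" for t :: real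
  have "\<phi> 1 \<le> \<phi> 0"
  proof (rule DERIV_nonpos_imp_nonincreasing [where f = \<phi>])
    fix t :: real
    assume "0 \<le> t"
    have "(\<phi> has_real_derivative g (a + t *\<^sub>R v) \<bullet> v - g a \<bullet> v - K * t * (norm v)\<^sup>2) (at t)"
      unfolding \<phi>_def
      by (auto intro!: derivative_eq_intros has_real_derivative_along_line grad)
    moreover have "g (a + t *\<^sub>R v) \<bullet> v - g a \<bullet> v - K * t * (norm v)\<^sup>2 \<le> 0"
    proof (cases "t = 0")
      case False
      have "t * (g (a + t *\<^sub>R v) \<bullet> v - g a \<bullet> v) \<le> t * (K * t * (norm v)\<^sup>2)"
        using growth [of "a + t *\<^sub>R v"]
        by (simp add: inner_diff_left power_mult_distrib power2_eq_square algebra_simps)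
      with False \<open>0 \<le> t\<close> show ?thesis by simp
    qed simp
    ultimately show "\<exists>y. (\<phi> has_real_derivative y) (at t) \<and> y \<le> 0" by blast
  qed simp
  then show ?thesis by (simp add: \<phi>_def v_def)
qed

lemma quadratic_lower_bound:
  fixes f :: "'a::real_inner \<Rightarrow> real"
  assumes grad: "\<And>z. GDERIV f z :> g z"
    and growth: "\<And>z. (g z - g a) \<bullet> (z - a) \<ge> K * (norm (z - a))\<^sup>2"
  shows "f b \<ge> f a + g a \<bullet> (b - a) + K / 2 * (norm (b - a))\<^sup>2"
proof -
  have "- f b \<le> - f a + - g a \<bullet> (b - a) + (- K) / 2 * (norm (b - a))\<^sup>2"
  proof (rule quadratic_upper_bound)
    show "GDERIV (\<lambda>z. - f z) z :> - g z" for z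
      by (rule GDERIV_minus [OF grad])
    show "(- g z - - g a) \<bullet> (z - a) \<le> - K * (norm (z - a))\<^sup>2" for z
      using growth [of z] by (simp add: inner_diff_left)
  qed
  then show ?thesis by simp
qed

text \<open>
  This interpolates between strong convexity and cocoercivity, and both terms on the left are needed
  at full strength for the rate. Subtracting \<open>\<mu>/2 * \<bar>z\<bar>\<^sup>2\<close> from \<open>f\<close> leaves a convex function \<open>h\<close> with
  gradient \<open>e\<close> that still has the quadratic upper bound with constant \<open>M = L - \<mu>\<close>. Evaluating
  both models of \<open>h\<close> at a gradient step of length \<open>t\<close> shows that \<open>e\<close> is cocoercive with constant
  \<open>1 / M\<close>; written out in terms of \<open>g\<close> this is the claim.
\<close>

lemma gradient_coercivity:
  fixes f :: "'a::real_inner \<Rightarrow> real"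
  assumes grad: "\<And>z. GDERIV f z :> g z"
    and lower: "\<And>x z. \<mu> * (norm (x - z))\<^sup>2 \<le> (g x - g z) \<bullet> (x - z)"
    and upper: "\<And>x z. (g x - g z) \<bullet> (x - z) \<le> L * (norm (x - z))\<^sup>2"
  shows "(norm (g b - g a))\<^sup>2 + \<mu> * L * (norm (b - a))\<^sup>2 \<le> (\<mu> + L) * ((g b - g a) \<bullet> (b - a))"
proof -
  define M where "M = L - \<mu>"
  define h where "h z = f z - \<mu> / 2 * (z \<bullet> z)" for z
  define e where "e z = g z - \<mu> *\<^sub>R z" for z
  have gradh: "GDERIV h z :> e z" for z
    unfolding h_def e_def gderiv_def
    by (rule derivative_eq_intros grad [unfolded gderiv_def] refl
        | simp add: fun_eq_iff inner_diff_right inner_commute)+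
  have e_inner: "(e x - e z) \<bullet> (x - z) = (g x - g z) \<bullet> (x - z) - \<mu> * (norm (x - z))\<^sup>2" for x z
    by (simp add: e_def power2_norm_eq_inner algebra_simps inner_diff_left inner_diff_right inner_commute)
  have h_upper: "h z \<le> h x + e x \<bullet> (z - x) + M / 2 * (norm (z - x))\<^sup>2" for x z
  proof (rule quadratic_upper_bound [OF gradh])
    show "(e w - e x) \<bullet> (w - x) \<le> M * (norm (w - x))\<^sup>2" for w
      using upper [of w x] unfolding e_inner M_def left_diff_distrib by simp
  qed
  have h_lower: "h x + e x \<bullet> (z - x) \<le> h z" for x z
    using quadratic_lower_bound [OF gradh, where K = 0 and a = x and b = z] lower by (simp add: e_inner)
  \<comment> \<open>Both models of \<open>h\<close>, at \<open>x\<close> and at \<open>z\<close>, are compared at a gradient step \<open>w\<close> from \<open>z\<close>.\<close>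
  have half: "h x + e x \<bullet> (z - x) + (t - M / 2 * t\<^sup>2) * (norm (e z - e x))\<^sup>2 \<le> h z" for x z t
  proof -
    define w where "w = z - t *\<^sub>R (e z - e x)"
    have "h x + e x \<bullet> (w - x) \<le> h z + e z \<bullet> (w - z) + M / 2 * (norm (w - z))\<^sup>2"
      using h_lower [of x w] h_upper [of w z] by linarith
    then show ?thesis
      unfolding w_def power2_norm_eq_inner
      by (simp add: power2_eq_square inner_add_left inner_add_right inner_diff_left inner_diff_right
          inner_commute field_simps)
  qed
  define d where "d = e b - e a"
  have two: "(2 * t - M * t\<^sup>2) * (norm d)\<^sup>2 \<le> d \<bullet> (b - a)" for t
    using half [of a b t] half [of b a t]
    by (simp add: d_def norm_minus_commute inner_diff_left inner_diff_right algebra_simps)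
  have cocoercive: "(norm d)\<^sup>2 \<le> M * (d \<bullet> (b - a))"
  proof (cases "M > 0")
    case True
    then show ?thesis
      using two [of "1 / M"] by (simp add: field_simps power2_eq_square)
  next
    case False
    \<comment> \<open>Here \<open>two\<close> holds for arbitrarily large \<open>t\<close>, and its left side is at least \<open>2 t \<bar>d\<bar>\<^sup>2\<close>.\<close>
    have "d = 0"
    proof (rule ccontr)
      assume "d \<noteq> 0"
      then have "(norm d)\<^sup>2 > 0" by simp
      define t where "t = (d \<bullet> (b - a) + 1) / (2 * (norm d)\<^sup>2)"
      have "2 * t * (norm d)\<^sup>2 \<le> (2 * t - M * t\<^sup>2) * (norm d)\<^sup>2"
        using False by (intro mult_right_mono) (auto simp: mult_nonpos_nonneg)
      also have "\<dots> \<le> d \<bullet> (b - a)" by (rule two)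
      also have "2 * t * (norm d)\<^sup>2 = d \<bullet> (b - a) + 1"
        using \<open>d \<noteq> 0\<close> by (simp add: t_def field_simps)
      finally show False by simp
    qed
    then show ?thesis by simp
  qed
  define p where "p = (g b - g a) \<bullet> (b - a)"
  have "(norm d)\<^sup>2 = (norm (g b - g a))\<^sup>2 - 2 * \<mu> * p + \<mu>\<^sup>2 * (norm (b - a))\<^sup>2"
    unfolding d_def e_def p_def power2_norm_eq_inner
    by (simp add: power2_eq_square inner_diff_left inner_diff_right inner_commute algebra_simps)
  moreover have "d \<bullet> (b - a) = p - \<mu> * (norm (b - a))\<^sup>2"
    by (simp only: d_def e_inner p_def)
  with cocoercive have "(norm d)\<^sup>2 \<le> M * (p - \<mu> * (norm (b - a))\<^sup>2)" by simp
  ultimately show ?thesis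
    unfolding p_def [symmetric] by (simp add: M_def power2_eq_square algebra_simps)
qed

lemma GDERIV_gradient:
  fixes f :: "'a::euclidean_space \<Rightarrow> real"
  assumes "f differentiable (at z)"
  shows "GDERIV f z :> gradient f z"
proof -
  obtain f' where f': "(f has_derivative f') (at z)"
    using assms by (auto simp: differentiable_def)
  then have "linear f'" by (rule has_derivative_linear)
  then have "f' = (\<lambda>h. h \<bullet> adjoint f' 1)"
    using adjoint_works [of f' _ 1] by (simp add: fun_eq_iff)
  with f' have D: "GDERIV f z :> adjoint f' 1" by (simp add: gderiv_def)
  have "D' = adjoint f' 1" if "GDERIV f z :> D'" for D'
    using has_derivative_unique [OF that [unfolded gderiv_def] D [unfolded gderiv_def]]
    by (metis vector_eq_ldot)
  with D have "gradient f z = adjoint f' 1"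
    unfolding gradient_def by blast
  with D show ?thesis by simp
qed


section \<open>Extreme eigenvalues of Gram matrices\<close>

lemma symmetric_inner:
  fixes S :: "real ^ 'n ^ 'n"
  assumes "transpose S = S"
  shows "(S *v v) \<bullet> w = v \<bullet> (S *v w)"
  by (metis assms dot_lmul_matrix vector_transpose_matrix)

lemma transpose_mult_inner:
  fixes A :: "real ^ 'n ^ 'm"
  shows "(transpose A *v w) \<bullet> v = w \<bullet> (A *v v)"
  by (metis dot_lmul_matrix vector_transpose_matrix transpose_transpose)

text \<open>
  A minimizer \<open>w\<close> of the Rayleigh quotient is an eigenvector. The form
  \<open>Q v = v \<bullet> S v - t \<bar>v\<bar>\<^sup>2\<close> is nonnegative and vanishes at \<open>w\<close>, so its derivative at \<open>w\<close> in the
  direction of the residual \<open>d = S w - t w\<close> must vanish; this derivative is \<open>2 \<bar>d\<bar>\<^sup>2\<close>.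
\<close>

lemma symmetric_least_eigenvalue:
  fixes S :: "real ^ 'n ^ 'n"
  assumes sym: "transpose S = S"
  obtains t where "t \<in> eigenvalues S" "\<And>v. t * (norm v)\<^sup>2 \<le> v \<bullet> (S *v v)"
proof -
  have "continuous_on (sphere 0 1) (\<lambda>v. v \<bullet> (S *v v))"
    by (intro continuous_intros linear_continuous_on_compose matrix_vector_mul_linear)
  moreover have "sphere (0 :: real ^ 'n) 1 \<noteq> {}" by simp
  ultimately obtain w where w: "norm w = 1"
    and w_min: "\<And>v. norm v = 1 \<Longrightarrow> w \<bullet> (S *v w) \<le> v \<bullet> (S *v v)"
    using continuous_attains_inf [OF compact_sphere, of 0 1 "\<lambda>v. v \<bullet> (S *v v)"]
    by (auto simp: dist_norm)
  define t where "t = w \<bullet> (S *v w)"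
  define Q where "Q v = v \<bullet> (S *v v) - t * (norm v)\<^sup>2" for v
  have Q_nonneg: "0 \<le> Q v" for v
  proof (cases "v = 0")
    case False
    have "t \<le> (v /\<^sub>R norm v) \<bullet> (S *v (v /\<^sub>R norm v))"
      unfolding t_def using False by (intro w_min) simp
    then show ?thesis
      using False by (simp add: Q_def matrix_vector_mult_scaleR field_simps power2_eq_square)
  qed (simp add: Q_def)
  define d where "d = S *v w - t *\<^sub>R w"
  have Q_line: "Q (w + s *\<^sub>R d) = 2 * s * (norm d)\<^sup>2 + s\<^sup>2 * Q d" for s
  proof -
    have "w \<bullet> (S *v d) = (S *v w) \<bullet> d" by (simp add: symmetric_inner [OF sym])
    moreover have "S *v w = d + t *\<^sub>R w" by (simp add: d_def)
    moreover have "w \<bullet> w = 1" using w by (simp add: norm_eq_1)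
    moreover have "d \<bullet> w = 0"
      using \<open>w \<bullet> w = 1\<close> by (simp add: d_def t_def inner_diff_left inner_diff_right inner_commute)
    ultimately show ?thesis
      unfolding Q_def power2_norm_eq_inner
      by (simp add: matrix_vector_right_distrib matrix_vector_mult_scaleR
          inner_add_left inner_add_right inner_commute power2_eq_square algebra_simps)
  qed
  have "d = 0"
  proof (rule ccontr)
    assume "d \<noteq> 0"
    \<comment> \<open>A negative step for which the linear term dominates; the summand 1 avoids division by zero.\<close>
    define s where "s = - (norm d)\<^sup>2 / (Q d + 1)"
    have "Q d + 1 > 0" using Q_nonneg [of d] by simp
    then have "s < 0" using \<open>d \<noteq> 0\<close> by (simp add: s_def divide_neg_pos)
    have "0 \<le> s * (2 * (norm d)\<^sup>2 + s * Q d)"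
      using Q_nonneg [of "w + s *\<^sub>R d"] by (simp add: Q_line power2_eq_square algebra_simps)
    with \<open>s < 0\<close> have "2 * (norm d)\<^sup>2 + s * Q d \<le> 0"
      by (simp add: zero_le_mult_iff)
    moreover have "s * Q d = s * (Q d + 1) - s" by (simp add: algebra_simps)
    moreover have "s * (Q d + 1) = - (norm d)\<^sup>2"
      using \<open>Q d + 1 > 0\<close> by (simp add: s_def)
    ultimately have "(norm d)\<^sup>2 \<le> s" by simp
    with \<open>s < 0\<close> show False
      using zero_le_power2 [of "norm d"] by linarith
  qed
  then have "S *v w = t *s w" by (simp add: d_def scalar_mult_eq_scaleR)
  moreover have "w \<noteq> 0" using w by auto
  ultimately have "t \<in> eigenvalues S" by (auto simp: eigenvalues_def)
  then show ?thesis
    using that Q_nonneg unfolding Q_def by auto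
qed

text \<open>
  Eigenvectors for distinct eigenvalues of a symmetric matrix are orthogonal, hence linearly
  independent. Finiteness is what makes the \<open>Max\<close> and \<open>Min\<close> in the definitions of \<open>lambda_max\<close> and
  \<open>lambda_min_nonzero\<close> meaningful.
\<close>

lemma finite_eigenvalues_symmetric:
  fixes S :: "real ^ 'n ^ 'n"
  assumes sym: "transpose S = S"
  shows "finite (eigenvalues S)"
proof -
  define v where "v t = (SOME v. v \<noteq> 0 \<and> S *v v = t *s v)" for t
  have v: "v t \<noteq> 0 \<and> S *v v t = t *s v t" if "t \<in> eigenvalues S" for t
    using that unfolding v_def eigenvalues_def mem_Collect_eq by (rule someI_ex)
  have orth: "v s \<bullet> v t = 0" if "s \<in> eigenvalues S" "t \<in> eigenvalues S" "s \<noteq> t" for s t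
    using symmetric_inner [OF sym, of "v s" "v t"] v [OF that(1)] v [OF that(2)] that(3)
    by (simp add: scalar_mult_eq_scaleR)
  have inj: "inj_on v (eigenvalues S)"
    by (rule inj_onI) (metis orth v inner_eq_zero_iff)
  have "pairwise orthogonal (v ` eigenvalues S)"
    unfolding pairwise_def orthogonal_def using orth by fast
  moreover have "0 \<notin> v ` eigenvalues S" using v by force
  ultimately have "independent (v ` eigenvalues S)"
    by (rule pairwise_orthogonal_independent)
  then have "finite (v ` eigenvalues S)" by (rule finiteI_independent)
  then show ?thesis using inj finite_imageD by blast
qed

text \<open>
  The negative of the least eigenvalue of \<open>- S\<close> is an eigenvalue of \<open>S\<close> that bounds the form.
\<close>

lemma rayleigh_le_lambda_max:
  fixes S :: "real ^ 'n ^ 'n"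
  assumes sym: "transpose S = S"
  shows "v \<bullet> (S *v v) \<le> lambda_max S * (norm v)\<^sup>2"
proof -
  have "transpose (- S) = - S"
    using sym by (simp add: transpose_def vec_eq_iff)
  then obtain t where t: "t \<in> eigenvalues (- S)" "\<And>v. t * (norm v)\<^sup>2 \<le> v \<bullet> ((- S) *v v)"
    by (rule symmetric_least_eigenvalue) blast
  have neg: "(- S) *v v = - (S *v v)" for v
    by (simp add: matrix_vector_mult_def vec_eq_iff sum_negf)
  obtain w where "w \<noteq> 0" "- (S *v w) = t *\<^sub>R w"
    using t(1) unfolding eigenvalues_def neg scalar_mult_eq_scaleR by blast
  then have "S *v w = (- t) *s w"
    by (metis add.inverse_inverse scaleR_minus_left scalar_mult_eq_scaleR)
  with \<open>w \<noteq> 0\<close> have "- t \<in> eigenvalues S"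
    unfolding eigenvalues_def by blast
  then have "- t \<le> lambda_max S"
    unfolding lambda_max_def by (intro Max_ge finite_eigenvalues_symmetric [OF sym])
  then have "- t * (norm v)\<^sup>2 \<le> lambda_max S * (norm v)\<^sup>2"
    by (intro mult_right_mono) auto
  then show ?thesis using t(2) [of v] by (simp add: neg)
qed

lemma norm_mult_le_lambda_max_gram:
  fixes U :: "real ^ 'n ^ 'm"
  shows "(norm (U *v v))\<^sup>2 \<le> lambda_max (transpose U ** U) * (norm v)\<^sup>2"
proof -
  have "v \<bullet> ((transpose U ** U) *v v) = (norm (U *v v))\<^sup>2"
    using transpose_mult_inner [of U "U *v v" v]
    by (simp add: matrix_vector_mul_assoc [symmetric] power2_norm_eq_inner inner_commute)
  with rayleigh_le_lambda_max [of "transpose U ** U" v] show ?thesis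
    by (simp add: matrix_transpose_mul)
qed

text \<open>
  If \<open>transpose U\<close> is injective then \<open>U ** transpose U\<close> is positive definite, and \<open>transpose U\<close> carries
  its eigenvectors to eigenvectors of \<open>transpose U ** U\<close> for the same, nonzero, eigenvalue. So the least
  eigenvalue of the former matrix is at least the smallest nonzero eigenvalue of the latter.
\<close>

lemma lambda_min_nonzero_gram:
  fixes U :: "real ^ 'n ^ 'm"
  assumes inj: "inj ((*v) (transpose U))"
  shows "0 < lambda_min_nonzero (transpose U ** U)"
    and "lambda_min_nonzero (transpose U ** U) * (norm w)\<^sup>2 \<le> (norm (transpose U *v w))\<^sup>2"
proof -
  let ?G = "transpose U ** U"
  have "transpose (U ** transpose U) = U ** transpose U"
    by (simp add: matrix_transpose_mul)
  then obtain t where t: "t \<in> eigenvalues (U ** transpose U)"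
    and t_min: "\<And>w. t * (norm w)\<^sup>2 \<le> w \<bullet> ((U ** transpose U) *v w)"
    by (rule symmetric_least_eigenvalue) blast
  have form: "w \<bullet> ((U ** transpose U) *v w) = (norm (transpose U *v w))\<^sup>2" for w
    using transpose_mult_inner [of U w "transpose U *v w"]
    by (simp add: matrix_vector_mul_assoc [symmetric] power2_norm_eq_inner)
  have inj0: "transpose U *v w \<noteq> 0" if "w \<noteq> 0" for w
    using inj that by (metis injD matrix_vector_mult_0_right)
  from t obtain w0 where w0: "w0 \<noteq> 0" "U *v (transpose U *v w0) = t *s w0"
    unfolding eigenvalues_def matrix_vector_mul_assoc by blast
  have "t * (norm w0)\<^sup>2 = (norm (transpose U *v w0))\<^sup>2"
    using form [of w0] w0(2)
    by (simp add: matrix_vector_mul_assoc [symmetric] scalar_mult_eq_scaleR power2_norm_eq_inner)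
  then have "t \<noteq> 0" using inj0 [OF w0(1)] by auto
  have "?G *v (transpose U *v w0) = t *s (transpose U *v w0)"
    using arg_cong [OF w0(2), of "\<lambda>z. transpose U *v z"]
    by (simp add: matrix_vector_mul_assoc [symmetric] scalar_mult_eq_scaleR matrix_vector_mult_scaleR)
  then have t_in: "t \<in> eigenvalues ?G - {0}"
    using inj0 [OF w0(1)] \<open>t \<noteq> 0\<close> by (auto simp: eigenvalues_def)
  have fin: "finite (eigenvalues ?G - {0})"
    using finite_eigenvalues_symmetric [of ?G] by (simp add: matrix_transpose_mul)
  have pos: "0 < s" if "s \<in> eigenvalues ?G - {0}" for s
  proof -
    from that obtain v where v: "v \<noteq> 0" "?G *v v = s *s v" and "s \<noteq> 0"
      by (auto simp: eigenvalues_def)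
    have "s * (norm v)\<^sup>2 = (norm (U *v v))\<^sup>2"
      using transpose_mult_inner [of U "U *v v" v] v(2)
      by (simp add: matrix_vector_mul_assoc [symmetric] power2_norm_eq_inner scalar_mult_eq_scaleR)
    then have "0 \<le> s" using v(1) by (metis zero_le_power2 zero_le_mult_iff norm_eq_zero
          zero_less_power2 not_less)
    with \<open>s \<noteq> 0\<close> show ?thesis by simp
  qed
  have "lambda_min_nonzero ?G \<in> eigenvalues ?G - {0}"
    unfolding lambda_min_nonzero_def using fin t_in by (intro Min_in) auto
  then show "0 < lambda_min_nonzero ?G" by (rule pos)
  have "lambda_min_nonzero ?G \<le> t"
    unfolding lambda_min_nonzero_def using fin t_in by (rule Min_le)
  then have "lambda_min_nonzero ?G * (norm w)\<^sup>2 \<le> t * (norm w)\<^sup>2"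
    by (intro mult_right_mono) auto
  also have "\<dots> \<le> (norm (transpose U *v w))\<^sup>2"
    using t_min [of w] by (simp add: form)
  finally show "lambda_min_nonzero ?G * (norm w)\<^sup>2 \<le> (norm (transpose U *v w))\<^sup>2" .
qed


section \<open>Matrices acting on stacked vectors\<close>

lemma column_matrix_mult:
  fixes A :: "real ^ 'n ^ 'm" and X :: "real ^ 'p ^ 'n"
  shows "column j (A ** X) = A *v column j X"
  by (simp add: vec_eq_iff column_def matrix_matrix_mult_def matrix_vector_mult_def)

lemma inner_eq_sum_columns:
  fixes X Y :: "real ^ 'p ^ 'n"
  shows "X \<bullet> Y = (\<Sum>j\<in>UNIV. column j X \<bullet> column j Y)"
  by (simp add: inner_vec_def column_def sum.swap [of _ "UNIV :: 'p set"])

lemma norm2_eq_sum_columns: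
  fixes X :: "real ^ 'p ^ 'n"
  shows "(norm X)\<^sup>2 = (\<Sum>j\<in>UNIV. (norm (column j X))\<^sup>2)"
  by (simp add: power2_norm_eq_inner inner_eq_sum_columns)

lemma matrix_mult_inner_adjoint:
  fixes A :: "real ^ 'n ^ 'm" and X :: "real ^ 'p ^ 'm" and Y :: "real ^ 'p ^ 'n"
  shows "(transpose A ** X) \<bullet> Y = X \<bullet> (A ** Y)"
  unfolding inner_eq_sum_columns column_matrix_mult transpose_mult_inner ..

lemma matrix_diff_ldistrib:
  fixes A :: "real ^ 'n ^ 'm" and B C :: "real ^ 'p ^ 'n"
  shows "A ** (B - C) = A ** B - A ** C"
  by (simp add: vec_eq_iff matrix_matrix_mult_def right_diff_distrib sum_subtractf)

lemma norm_mult_le: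
  fixes U :: "real ^ 'n ^ 'm" and X :: "real ^ 'p ^ 'n"
  assumes "lambda_max (transpose U ** U) \<le> 1"
  shows "norm (U ** X) \<le> norm X"
proof -
  have "(norm (U *v v))\<^sup>2 \<le> (norm v)\<^sup>2" for v
  proof -
    note norm_mult_le_lambda_max_gram [of U v]
    also have "lambda_max (transpose U ** U) * (norm v)\<^sup>2 \<le> 1 * (norm v)\<^sup>2"
      using assms by (rule mult_right_mono) simp
    finally show ?thesis by simp
  qed
  then have "(norm (U ** X))\<^sup>2 \<le> (norm X)\<^sup>2"
    unfolding norm2_eq_sum_columns column_matrix_mult by (intro sum_mono)
  then show ?thesis by (rule power2_le_imp_le) simp
qed

text \<open>
  A matrix and its transpose have the same operator norm; Cauchy-Schwarz transfers the bound.
\<close>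

lemma norm_transpose_mult_le:
  fixes U :: "real ^ 'n ^ 'm" and Z :: "real ^ 'p ^ 'm"
  assumes "lambda_max (transpose U ** U) \<le> 1"
  shows "norm (transpose U ** Z) \<le> norm Z"
proof -
  let ?Y = "transpose U ** Z"
  have "norm ?Y * norm ?Y = Z \<bullet> (U ** ?Y)"
    using matrix_mult_inner_adjoint [of U Z ?Y] 
    by (simp add: power2_norm_eq_inner [symmetric] power2_eq_square)
  also have "\<dots> \<le> norm Z * norm (U ** ?Y)" by (rule norm_cauchy_schwarz)
  also have "\<dots> \<le> norm Z * norm ?Y"
    using norm_mult_le [OF assms, of ?Y] by (intro mult_left_mono) simp_all
  finally show ?thesis by (cases "norm ?Y = 0") (simp_all add: mult_le_cancel_right)
qed

lemma lambda_min_nonzero_le_transpose_mult: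
  fixes U :: "real ^ 'n ^ 'm" and Z :: "real ^ 'p ^ 'm"
  assumes "inj ((*v) (transpose U))"
  shows "lambda_min_nonzero (transpose U ** U) * (norm Z)\<^sup>2 \<le> (norm (transpose U ** Z))\<^sup>2"
  unfolding norm2_eq_sum_columns column_matrix_mult sum_distrib_left
  by (intro sum_mono lambda_min_nonzero_gram assms)

text \<open>
  For the matrix of local gradients the right-hand side is the consensus condition.
\<close>

lemma mult_eq_0_iff_rows_equal:
  fixes U :: "real ^ 'n ^ 'm" and X :: "real ^ 'p ^ 'n"
  assumes "{v. U *v v = 0} = {a *s 1 |a. True}"
  shows "U ** X = 0 \<longleftrightarrow> (\<forall>i k. X $ i = X $ k)"
proof -
  have kernel: "U *v v = 0 \<longleftrightarrow> (\<forall>i k. v $ i = v $ k)" for v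
  proof -
    have "U *v v = 0 \<longleftrightarrow> (\<exists>a. v = a *s 1)" using assms by blast
    also have "\<dots> \<longleftrightarrow> (\<forall>i k. v $ i = v $ k)"
      by (auto simp: vec_eq_iff)
    finally show ?thesis .
  qed
  have "U ** X = 0 \<longleftrightarrow> (\<forall>j. column j (U ** X) = 0)"
    by (auto simp: vec_eq_iff column_def)
  also have "\<dots> \<longleftrightarrow> (\<forall>i k. X $ i = X $ k)"
    unfolding column_matrix_mult kernel by (auto simp: vec_eq_iff column_def)
  finally show ?thesis .
qed

text \<open>
  The range of \<open>transpose U\<close> is the orthogonal complement of the kernel of \<open>U\<close>. The preimage comes from
  solving the normal equations \<open>U (transpose U Z) = U X\<close>: the residual \<open>D\<close> lies in the kernel, so its
  rows are equal, and they sum to zero.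
\<close>

lemma zero_sum_in_range_transpose:
  fixes U :: "real ^ 'n ^ 'm" and X :: "real ^ 'p ^ 'n"
  assumes kernel: "{v. U *v v = 0} = {a *s 1 |a. True}"
    and inj: "inj ((*v) (transpose U))"
    and sum: "(\<Sum>i\<in>UNIV. X $ i) = 0"
  obtains Z where "X = transpose U ** Z"
proof -
  have "inj ((*v) (U ** transpose U))"
  proof (rule injI)
    fix w1 w2
    assume "(U ** transpose U) *v w1 = (U ** transpose U) *v w2"
    then have "U *v (transpose U *v (w1 - w2)) = 0"
      unfolding matrix_vector_mul_assoc matrix_vector_mult_diff_distrib by simp
    then have "transpose U *v (w1 - w2) = 0"
      using transpose_mult_inner [of U "w1 - w2" "transpose U *v (w1 - w2)"] by simp
    then have "transpose U *v w1 = transpose U *v w2"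
      by (simp add: matrix_vector_mult_diff_distrib)
    then show "w1 = w2" by (rule injD [OF inj])
  qed
  then obtain B where "B ** (U ** transpose U) = mat 1"
    using matrix_left_invertible_injective by blast
  then have B: "(U ** transpose U) ** B = mat 1"
    using matrix_left_right_inverse by blast
  define Z where "Z = B ** (U ** X)"
  define D where "D = X - transpose U ** Z"
  have "U ** (transpose U ** Z) = U ** X"
    using B by (simp add: Z_def matrix_mul_assoc)
  then have "U ** D = 0" by (simp add: D_def matrix_diff_ldistrib)
  then have rows: "D $ i = D $ k" for i k
    using mult_eq_0_iff_rows_equal [OF kernel] by blast
  have "U *v 1 = 0" using kernel by (metis (mono_tags, lifting) mem_Collect_eq vector_smult_lid)
  have "(\<Sum>i\<in>UNIV. (transpose U ** Z) $ i) = 0"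
  proof (rule vec_eq_iff [THEN iffD2], rule allI)
    fix j
    have "(\<Sum>i\<in>UNIV. (transpose U ** Z) $ i) $ j = (transpose U *v column j Z) \<bullet> 1"
      unfolding column_matrix_mult [symmetric] by (simp add: column_def inner_vec_def)
    then show "(\<Sum>i\<in>UNIV. (transpose U ** Z) $ i) $ j = 0 $ j"
      unfolding transpose_mult_inner \<open>U *v 1 = 0\<close> by simp
  qed
  then have "(\<Sum>i\<in>UNIV. D $ i) = 0" using sum by (simp add: D_def sum_subtractf)
  moreover have "(\<Sum>i\<in>UNIV. D $ i) = real CARD('n) *\<^sub>R D $ k" for k
  proof -
    have "(\<Sum>i\<in>UNIV. D $ i) = (\<Sum>i\<in>(UNIV :: 'n set). D $ k)"
      by (rule sum.cong [OF refl]) (rule rows)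
    then show ?thesis by (simp only: sum_constant_scaleR)
  qed
  ultimately have "D = 0" by (simp add: vec_eq_iff)
  then show ?thesis using that by (simp add: D_def)
qed


section \<open>The constrained minimum\<close>

text \<open>
  By the quadratic lower bound at \<open>a\<close>, the function exceeds \<open>F a\<close> outside a ball around \<open>a\<close>, so that
  only a compact part of \<open>S\<close> matters.
\<close>

lemma strongly_monotone_attains_min:
  fixes F :: "'a::euclidean_space \<Rightarrow> real"
  assumes grad: "\<And>z. GDERIV F z :> G z"
    and mono: "\<And>x z. \<mu> * (norm (x - z))\<^sup>2 \<le> (G x - G z) \<bullet> (x - z)"
    and "\<mu> > 0" "closed S" "a \<in> S"
  shows "\<exists>m\<in>S. \<forall>x\<in>S. F m \<le> F x"
proof -
  define R where "R = 2 * norm (G a) / \<mu>"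
  have outside: "F a < F x" if "R < norm (x - a)" for x
  proof -
    have "0 \<le> R" using \<open>\<mu> > 0\<close> by (simp add: R_def)
    have "norm (G a) < \<mu> / 2 * norm (x - a)"
      using that \<open>\<mu> > 0\<close> by (simp add: R_def field_simps)
    moreover have "0 < norm (x - a)" using that \<open>0 \<le> R\<close> by linarith
    ultimately have "norm (G a) * norm (x - a) < \<mu> / 2 * norm (x - a) * norm (x - a)"
      by (rule mult_strict_right_mono)
    moreover have "- (norm (G a) * norm (x - a)) \<le> G a \<bullet> (x - a)"
      using Cauchy_Schwarz_ineq2 [of "G a" "x - a"] by linarith
    ultimately show ?thesis
      using quadratic_lower_bound [OF grad, of \<mu> a x] mono by (simp add: power2_eq_square)
  qed
  have "continuous_on UNIV F"
    using grad unfolding gderiv_def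
    by (intro differentiable_imp_continuous_on) (auto simp: differentiable_on_def differentiable_def)
  then have cont: "continuous_on (S \<inter> cball a R) F" by (rule continuous_on_subset) simp
  have "compact (S \<inter> cball a R)" using \<open>closed S\<close> by (simp add: closed_Int_compact)
  moreover have a_in: "a \<in> S \<inter> cball a R" using \<open>a \<in> S\<close> \<open>\<mu> > 0\<close> by (simp add: R_def)
  ultimately obtain m where m: "m \<in> S" "\<And>x. x \<in> S \<inter> cball a R \<Longrightarrow> F m \<le> F x"
    using continuous_attains_inf [OF _ _ cont] by blast
  have "F m \<le> F x" if "x \<in> S" for x
  proof (cases "R < norm (x - a)")
    case True
    with outside m(2) [OF a_in] show ?thesis by force
  next
    case False
    with that show ?thesis by (intro m(2)) (simp add: dist_norm norm_minus_commute)
  qed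
  with m(1) show ?thesis by blast
qed

lemma gradient_orthogonal_at_min:
  fixes F :: "'a::real_inner \<Rightarrow> real"
  assumes "GDERIV F m :> d" and "\<And>t. F m \<le> F (m + t *\<^sub>R v)"
  shows "d \<bullet> v = 0"
proof -
  have "((\<lambda>s. F (m + s *\<^sub>R v)) has_real_derivative d \<bullet> v) (at 0)"
    using assms(1) by (intro has_real_derivative_along_line) simp
  then show ?thesis
    by (rule DERIV_local_min [of _ _ 0 1]) (use assms(2) in auto)
qed

lemma GDERIV_sum_rows:
  fixes f :: "'n::finite \<Rightarrow> real ^ 'p \<Rightarrow> real"
  assumes "\<And>i z. f i differentiable (at z)"
  shows "GDERIV (\<lambda>x. \<Sum>i\<in>UNIV. f i (x $ i)) x :> (\<chi> i. gradient (f i) (x $ i))"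
proof -
  have "((\<lambda>x. f i (x $ i)) has_derivative (\<lambda>h. h $ i \<bullet> gradient (f i) (x $ i))) (at x)" for i
    using GDERIV_gradient [OF assms, of i "x $ i"] unfolding gderiv_def
    by (rule has_derivative_compose [OF bounded_linear_imp_has_derivative [OF bounded_linear_vec_nth]])
  then show ?thesis
    unfolding gderiv_def inner_vec_def by (simp add: has_derivative_sum)
qed

lemma norm2_vec_eq_sum:
  fixes x :: "'a::real_inner ^ 'n"
  shows "(norm x)\<^sup>2 = (\<Sum>i\<in>UNIV. (norm (x $ i))\<^sup>2)"
  by (simp add: power2_norm_eq_inner inner_vec_def)

lemma stacked_gradient_strongly_monotone:
  fixes f :: "'n::finite \<Rightarrow> real ^ 'p \<Rightarrow> real" and x z :: "real ^ 'p ^ 'n"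
  assumes "\<And>i. strongly_convex (\<mu>i i) (f i)" and "\<And>i. \<mu> \<le> \<mu>i i"
  shows "\<mu> * (norm (x - z))\<^sup>2 \<le>
    ((\<chi> i. gradient (f i) (x $ i)) - (\<chi> i. gradient (f i) (z $ i))) \<bullet> (x - z)"
  unfolding norm2_vec_eq_sum [of "x - z"] inner_vec_def [of _ "x - z"] sum_distrib_left
proof (rule sum_mono)
  fix i
  have "\<mu> * (norm (x $ i - z $ i))\<^sup>2 \<le> \<mu>i i * (norm (x $ i - z $ i))\<^sup>2"
    using assms(2) by (intro mult_right_mono) simp_all
  also have "\<dots> \<le> (gradient (f i) (x $ i) - gradient (f i) (z $ i)) \<bullet> (x $ i - z $ i)"
    using assms(1) by (simp add: strongly_convex_def)
  finally show "\<mu> * (norm ((x - z) $ i))\<^sup>2 \<le>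
      ((\<chi> i. gradient (f i) (x $ i)) - (\<chi> i. gradient (f i) (z $ i))) $ i \<bullet> (x - z) $ i"
    by simp
qed

lemma stacked_gradient_lipschitz:
  fixes f :: "'n::finite \<Rightarrow> real ^ 'p \<Rightarrow> real" and x z :: "real ^ 'p ^ 'n"
  assumes "\<And>i. (Li i)-lipschitz_on UNIV (gradient (f i))" and "\<And>i. Li i \<le> L" and "0 \<le> L"
  shows "norm ((\<chi> i. gradient (f i) (x $ i)) - (\<chi> i. gradient (f i) (z $ i))) \<le> L * norm (x - z)"
proof (rule power2_le_imp_le)
  show "(norm ((\<chi> i. gradient (f i) (x $ i)) - (\<chi> i. gradient (f i) (z $ i))))\<^sup>2 \<le> (L * norm (x - z))\<^sup>2"
    unfolding power_mult_distrib norm2_vec_eq_sum [of "x - z"] sum_distrib_left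
      norm2_vec_eq_sum [of "(\<chi> i. gradient (f i) (x $ i)) - (\<chi> i. gradient (f i) (z $ i))"]
  proof (rule sum_mono)
    fix i
    have "norm (gradient (f i) (x $ i) - gradient (f i) (z $ i)) \<le> Li i * norm (x $ i - z $ i)"
      using lipschitz_onD [OF assms(1)] by (simp add: dist_norm)
    also have "\<dots> \<le> L * norm (x $ i - z $ i)"
      using assms(2) by (intro mult_right_mono) simp_all
    finally have "norm (gradient (f i) (x $ i) - gradient (f i) (z $ i)) \<le> L * norm (x $ i - z $ i)" .
    from power_mono [OF this, of 2]
    show "(norm (((\<chi> i. gradient (f i) (x $ i)) - (\<chi> i. gradient (f i) (z $ i))) $ i))\<^sup>2
        \<le> L\<^sup>2 * (norm ((x - z) $ i))\<^sup>2"
      by (simp add: power_mult_distrib)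
  qed
qed (use assms(3) in simp)

text \<open>
  Moving mass \<open>w\<close> from row \<open>k\<close> to row \<open>i\<close> preserves the constraint, so the gradient is orthogonal to
  that direction; \<open>w\<close> is chosen as the difference of the two rows of the gradient.
\<close>

lemma rows_equal_at_constrained_min:
  fixes F :: "real ^ 'p ^ 'n \<Rightarrow> real"
  assumes grad: "GDERIV F m :> d"
    and feasible: "(\<Sum>i\<in>UNIV. m $ i - r $ i) = 0"
    and min: "\<And>x. (\<Sum>i\<in>UNIV. x $ i - r $ i) = 0 \<Longrightarrow> F m \<le> F x"
  shows "d $ i = d $ k"
proof -
  define w where "w = d $ i - d $ k"
  have "d \<bullet> (axis i w - axis k w) = 0"
  proof (rule gradient_orthogonal_at_min [OF grad])
    fix t :: real
    have "(\<Sum>j\<in>UNIV. (axis i w - axis k w :: real ^ 'p ^ 'n) $ j) = 0"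
      by (simp add: axis_def sum_subtractf)
    then have "(\<Sum>j\<in>UNIV. (m + t *\<^sub>R (axis i w - axis k w)) $ j - r $ j) = 0"
      using feasible
      by (simp add: sum_subtractf sum.distrib scaleR_sum_right [symmetric] del: vector_minus_component)
    then show "F m \<le> F (m + t *\<^sub>R (axis i w - axis k w))" by (rule min)
  qed
  then have "w \<bullet> w = 0"
    by (simp add: inner_diff_right inner_axis w_def inner_diff_left)
  then show ?thesis by (simp add: w_def)
qed

text \<open>
  The constraint set is an affine subspace whose directions have zero row sum, and the gradient at a
  minimizer \<open>m\<close> has equal rows, hence is orthogonal to these directions. The quadratic lower bound at
  \<open>m\<close> then gives uniqueness.
\<close>

lemma optimal_solution_exists:
  fixes f :: "'n::finite \<Rightarrow> real ^ 'p \<Rightarrow> real" and r :: "real ^ 'p ^ 'n"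
  defines "G \<equiv> \<lambda>x :: real ^ 'p ^ 'n. \<chi> i. gradient (f i) (x $ i)"
  assumes diff: "\<And>i z. f i differentiable (at z)"
    and mono: "\<And>x z. \<mu> * (norm (x - z))\<^sup>2 \<le> (G x - G z) \<bullet> (x - z)" and "\<mu> > 0"
  shows "\<exists>xs. optimal_solution f r xs \<and> (\<forall>z. optimal_solution f r z \<longrightarrow> z = xs) \<and>
    (\<Sum>i\<in>UNIV. xs $ i - r $ i) = 0 \<and> (\<forall>i k. G xs $ i = G xs $ k)"
proof -
  define F where "F x = (\<Sum>i\<in>UNIV. f i (x $ i))" for x :: "real ^ 'p ^ 'n"
  define S where "S = {x. (\<Sum>i\<in>UNIV. x $ i - r $ i) = 0}"
  have grad: "GDERIV F x :> G x" for x
    unfolding F_def G_def by (rule GDERIV_sum_rows [OF diff])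
  have "closed S"
    unfolding S_def by (intro closed_Collect_eq continuous_intros)
  have "r \<in> S" by (simp add: S_def)
  obtain m where m: "m \<in> S" and m_min: "\<And>x. x \<in> S \<Longrightarrow> F m \<le> F x"
    using strongly_monotone_attains_min [OF grad mono \<open>\<mu> > 0\<close> \<open>closed S\<close> \<open>r \<in> S\<close>] by blast
  have opt: "optimal_solution f r z \<longleftrightarrow> z \<in> S \<and> (\<forall>x\<in>S. F z \<le> F x)" for z
    unfolding optimal_solution_def is_arg_min_linorder F_def S_def by auto
  have rows: "G m $ i = G m $ k" for i k
    using m m_min unfolding S_def by (intro rows_equal_at_constrained_min [OF grad]) auto
  have "z = m" if "optimal_solution f r z" for z
  proof -
    from that have z: "z \<in> S" "F z \<le> F m" using opt m by auto
    have "(\<Sum>i\<in>UNIV. (z - m) $ i) = 0"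
      using m z(1) by (simp add: S_def sum_subtractf)
    moreover have "G m \<bullet> (z - m) = (\<Sum>i\<in>UNIV. G m $ k \<bullet> (z - m) $ i)" for k
      unfolding inner_vec_def by (rule sum.cong [OF refl]) (metis rows)
    ultimately have "G m \<bullet> (z - m) = 0"
      by (simp add: inner_sum_right [symmetric])
    moreover have "F m + G m \<bullet> (z - m) + \<mu> / 2 * (norm (z - m))\<^sup>2 \<le> F z"
      using mono by (rule quadratic_lower_bound [OF grad])
    ultimately have "\<mu> * (norm (z - m))\<^sup>2 \<le> 0" using z(2) by simp
    then show ?thesis using \<open>\<mu> > 0\<close> by (simp add: mult_le_0_iff)
  qed
  then show ?thesis
    using opt m m_min rows by (intro exI [of _ m]) (auto simp: S_def)
qed


section \<open>The Lyapunov inequality\<close>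

text \<open>
  Young's inequality; its weight is the free parameter \<open>\<gamma>\<close> of the rate.
\<close>

lemma norm_add_square_weighted:
  fixes a b :: "'a::real_inner"
  assumes "\<gamma> > 0"
  shows "(norm (a + b))\<^sup>2 \<le> (1 + \<gamma>) * (norm a)\<^sup>2 + (1 + 1 / \<gamma>) * (norm b)\<^sup>2"
proof -
  have "0 \<le> (norm (\<gamma> *\<^sub>R a - b))\<^sup>2 / \<gamma>" using assms by simp
  also have "\<dots> = \<gamma> * (norm a)\<^sup>2 - 2 * (a \<bullet> b) + (norm b)\<^sup>2 / \<gamma>"
    using assms unfolding power2_norm_eq_inner
    by (simp add: inner_diff_left inner_diff_right inner_commute field_simps power2_eq_square)
  finally show ?thesis
    unfolding power2_norm_eq_inner
    by (simp add: inner_add_left inner_add_right inner_commute algebra_simps)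
qed

text \<open>
  The three terms of the minimum in the form in which they are used: \<open>A\<close> and \<open>B\<close> are the coefficients
  with which \<open>\<delta> \<bar>q'\<bar>\<^sup>2\<close> is bounded by Young's inequality, up to powers of \<open>c\<close>.
\<close>

lemma rate_bound_iff:
  assumes pos: "\<mu> > 0" "L > 0" "c > 0" "l > 0" "\<gamma> > 0" "\<delta> > 0" and step: "2 * (c * L) < 1"
  defines "A \<equiv> \<delta> * (1 + \<gamma>) / l" and "B \<equiv> \<delta> * (1 + 1 / \<gamma>) / l" and "s \<equiv> c * L"
  shows "\<delta> \<le> rate_bound \<mu> L c l \<gamma> \<longleftrightarrow>
    A * (\<mu> + L) \<le> 2 * \<mu> * s \<and> A + s * (2 - 3 * s) * \<delta> + 2 * s\<^sup>2 * B \<le> s\<^sup>2 \<and> s * B \<le> 1 - 2 * s"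
proof -
  have s: "0 < s" "2 * s < 1" using pos step by (simp_all add: s_def)
  let ?D = "1 + \<gamma> + s * (2 - 3 * s) * l + 2 * s\<^sup>2 * (1 + 1 / \<gamma>)"
  have g: "0 < 1 + 1 / \<gamma>" "0 < 1 + \<gamma>" using pos by (simp_all add: add_pos_pos)
  have "0 < s * (2 - 3 * s) * l" using s pos by simp
  moreover have "0 \<le> 2 * s\<^sup>2 * (1 + 1 / \<gamma>)" using g by simp
  ultimately have D: "0 < ?D" using g by linarith
  have 1: "\<delta> \<le> 2 * \<mu> * L * c * l / ((\<mu> + L) * (1 + \<gamma>)) \<longleftrightarrow> A * (\<mu> + L) \<le> 2 * \<mu> * s"
    using pos g by (simp add: A_def s_def pos_le_divide_eq pos_divide_le_eq mult_ac)
  have "\<delta> \<le> c\<^sup>2 * L\<^sup>2 * l / ?D \<longleftrightarrow> \<delta> * ?D / l \<le> s\<^sup>2"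
    using pos D by (simp add: s_def pos_le_divide_eq pos_divide_le_eq power_mult_distrib)
  also have "\<delta> * ?D / l = A + s * (2 - 3 * s) * \<delta> + 2 * s\<^sup>2 * B"
    using pos by (simp add: A_def B_def field_simps)
  finally have 2: "\<delta> \<le> c\<^sup>2 * L\<^sup>2 * l / ?D \<longleftrightarrow> A + s * (2 - 3 * s) * \<delta> + 2 * s\<^sup>2 * B \<le> s\<^sup>2" .
  have 3: "\<delta> \<le> (1 - 2 * c * L) * l / (c * L * (1 + 1 / \<gamma>)) \<longleftrightarrow> s * B \<le> 1 - 2 * s"
    using pos g by (simp add: B_def s_def pos_le_divide_eq pos_divide_le_eq mult_ac)
  have D_eq: "?D = 1 + \<gamma> + c * L * (2 - 3 * c * L) * l + 2 * c\<^sup>2 * L\<^sup>2 * (1 + 1 / \<gamma>)"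
    by (simp add: s_def power_mult_distrib mult_ac)
  show ?thesis
    unfolding rate_bound_def D_eq [symmetric] by (simp add: 1 2 3)
qed

lemma rate_bound_pos:
  assumes "\<mu> > 0" "L > 0" "c > 0" "l > 0" "\<gamma> > 0" "2 * (c * L) < 1"
  shows "rate_bound \<mu> L c l \<gamma> > 0"
proof -
  have "0 < c * L" using assms by simp
  then have "0 < c * L * (2 - 3 * c * L) * l" using assms by simp
  moreover have "0 \<le> 2 * c\<^sup>2 * L\<^sup>2 * (1 + 1 / \<gamma>)" using assms by simp
  ultimately have "0 < 1 + \<gamma> + c * L * (2 - 3 * c * L) * l + 2 * c\<^sup>2 * L\<^sup>2 * (1 + 1 / \<gamma>)"
    using assms by linarith
  then show ?thesis
    unfolding rate_bound_def using assms by (auto intro!: divide_pos_pos mult_pos_pos add_pos_pos)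
qed

text \<open>
  One step of the iteration in terms of errors: \<open>q\<close> is the dual error, \<open>d\<close> the primal error, \<open>G\<close> the
  gradient error and \<open>u\<close> its image under \<open>U\<close>, with primes for the new iterate (\<open>d\<close> and \<open>G\<close> are new).
  The pairing identity gives the exact balance
  \<open>\<bar>q'\<bar>\<^sup>2 = \<bar>q\<bar>\<^sup>2 - \<bar>u\<bar>\<^sup>2 + \<bar>u' - u\<bar>\<^sup>2 - 2/c * (G \<bullet> d)\<close>. The additional amount \<open>\<delta> \<bar>q'\<bar>\<^sup>2\<close> is controlled,
  through the dual estimate, by \<open>d\<close> and \<open>u' - u\<close>. The part with \<open>d\<close> is paid by coercivity (first term of
  the rate bound), which leaves a multiple of \<open>\<bar>u'\<bar>\<^sup>2\<close> (nonnegative by the second and third terms). The part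
  with \<open>u' - u\<close> is split by \<open>\<bar>u' - u\<bar>\<^sup>2 \<le> 2 \<bar>u'\<bar>\<^sup>2 + 2 \<bar>u\<bar>\<^sup>2\<close>; the weight \<open>1 + 2 B\<close> is what this leaves in
  front of \<open>\<bar>u\<bar>\<^sup>2\<close>, and the second and third terms make the total coefficient of \<open>\<bar>u'\<bar>\<^sup>2\<close> nonpositive.
\<close>

lemma lyapunov_step:
  fixes q q' u u' :: "'b::real_inner" and d G :: "'a::real_inner"
  assumes q': "q' = q + u'"
    and pairing: "G \<bullet> d = c * (u' \<bullet> (u' - u) - u' \<bullet> q')"
    and dual: "c\<^sup>2 * l * (norm q')\<^sup>2 \<le> (1 + \<gamma>) * (norm d)\<^sup>2 + (1 + 1 / \<gamma>) * (c\<^sup>2 * (norm (u' - u))\<^sup>2)"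
    and u'_le: "norm u' \<le> norm G" and lipschitz: "norm G \<le> L * norm d"
    and coercive: "(norm G)\<^sup>2 + \<mu> * L * (norm d)\<^sup>2 \<le> (\<mu> + L) * (G \<bullet> d)"
    and pos: "\<mu> > 0" "L > 0" "c > 0" "l > 0" "\<gamma> > 0" "\<delta> > 0" and step: "2 * (c * L) < 1"
    and rate: "\<delta> \<le> rate_bound \<mu> L c l \<gamma>"
  defines "B \<equiv> \<delta> * (1 + 1 / \<gamma>) / l"
  shows "(1 + \<delta>) * ((norm q')\<^sup>2 + (1 + 2 * B) * (norm u')\<^sup>2) \<le> (norm q)\<^sup>2 + (1 + 2 * B) * (norm u)\<^sup>2"
proof -
  define A where "A = \<delta> * (1 + \<gamma>) / l"
  define s where "s = c * L"
  define \<alpha> where "\<alpha> = A / s\<^sup>2"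
  have s: "0 < s" using pos by (simp add: s_def)
  have bounds: "A * (\<mu> + L) \<le> 2 * \<mu> * s" "A + s * (2 - 3 * s) * \<delta> + 2 * s\<^sup>2 * B \<le> s\<^sup>2"
      "s * B \<le> 1 - 2 * s"
    using rate rate_bound_iff [OF pos step] unfolding A_def B_def s_def by blast+
  have "0 \<le> B" using pos by (simp add: B_def)
  have "s\<^sup>2 * \<alpha> = A" using s by (simp add: \<alpha>_def)
  moreover have "s\<^sup>2 * (1 - (2 / s - 3) * \<delta> - 2 * B) = s\<^sup>2 - s * (2 - 3 * s) * \<delta> - 2 * s\<^sup>2 * B"
    using s by (simp add: field_simps power2_eq_square)
  ultimately have "s\<^sup>2 * \<alpha> \<le> s\<^sup>2 * (1 - (2 / s - 3) * \<delta> - 2 * B)"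
    using bounds(2) by linarith
  then have \<alpha>_le: "\<alpha> \<le> 1 - (2 / s - 3) * \<delta> - 2 * B" using s by simp
  have B_le: "B \<le> 1 / s - 2" using bounds(3) s by (simp add: field_simps)
  have "0 \<le> (2 / s - 3) * \<delta>" using B_le \<open>0 \<le> B\<close> pos by simp
  then have "\<alpha> \<le> 2 / s" using \<alpha>_le B_le \<open>0 \<le> B\<close> by linarith

  \<comment> \<open>Coercivity provides more \<open>\<bar>d\<bar>\<^sup>2\<close> than the dual estimate consumes; the surplus \<open>\<rho> L\<^sup>2\<close> is traded for
    \<open>\<bar>G\<bar>\<^sup>2\<close> by the Lipschitz bound; the result no longer depends on \<open>\<mu>\<close>.\<close>
  have G2: "(norm G)\<^sup>2 \<le> L\<^sup>2 * (norm d)\<^sup>2"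
    using power_mono [OF lipschitz, of 2] by (simp add: power_mult_distrib)
  have u2: "(norm u')\<^sup>2 \<le> (norm G)\<^sup>2" using u'_le by (simp add: power_mono)
  have decrease: "A / c\<^sup>2 * (norm d)\<^sup>2 + (2 / s - \<alpha>) * (norm G)\<^sup>2 \<le> 2 / c * (G \<bullet> d)"
  proof -
    define \<rho> where "\<rho> = 2 * \<mu> / (s * (\<mu> + L)) - \<alpha>"
    have "A \<le> 2 * \<mu> * s / (\<mu> + L)"
      using bounds(1) pos by (simp add: pos_le_divide_eq)
    then have "\<alpha> \<le> 2 * \<mu> * s / (\<mu> + L) / s\<^sup>2"
      unfolding \<alpha>_def by (rule divide_right_mono) simp
    also have "\<dots> = 2 * \<mu> / (s * (\<mu> + L))"
      using s by (simp add: power2_eq_square)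
    finally have "0 \<le> \<rho>" by (simp add: \<rho>_def)
    have "2 / c * (((norm G)\<^sup>2 + \<mu> * L * (norm d)\<^sup>2) / (\<mu> + L)) \<le> 2 / c * (G \<bullet> d)"
      using coercive pos by (intro mult_left_mono) (simp_all add: field_simps)
    moreover have "2 / c * (((norm G)\<^sup>2 + \<mu> * L * (norm d)\<^sup>2) / (\<mu> + L)) =
        A / c\<^sup>2 * (norm d)\<^sup>2 + \<rho> * (L\<^sup>2 * (norm d)\<^sup>2) + 2 / (c * (\<mu> + L)) * (norm G)\<^sup>2"
    proof -
      have "\<alpha> * L\<^sup>2 = A / c\<^sup>2"
        using pos by (simp add: \<alpha>_def s_def power_mult_distrib)
      moreover have "2 * \<mu> / (s * (\<mu> + L)) * L\<^sup>2 = 2 * \<mu> * L / (c * (\<mu> + L))"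
        using pos by (simp add: s_def power2_eq_square)
      ultimately have "\<rho> * L\<^sup>2 = 2 * \<mu> * L / (c * (\<mu> + L)) - A / c\<^sup>2"
        unfolding \<rho>_def left_diff_distrib by simp
      then have expand: "\<rho> * (L\<^sup>2 * (norm d)\<^sup>2) = (2 * \<mu> * L / (c * (\<mu> + L)) - A / c\<^sup>2) * (norm d)\<^sup>2"
        by (simp only: mult.assoc [symmetric])
      show ?thesis
        unfolding expand left_diff_distrib by (simp add: add_divide_distrib distrib_left mult_ac)
    qed
    moreover have "\<rho> * (norm G)\<^sup>2 \<le> \<rho> * (L\<^sup>2 * (norm d)\<^sup>2)"
      using G2 \<open>0 \<le> \<rho>\<close> by (rule mult_left_mono)
    moreover have "\<rho> + 2 / (c * (\<mu> + L)) = 2 / s - \<alpha>"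
    proof -
      have "2 / (c * (\<mu> + L)) = 2 * L / (s * (\<mu> + L))"
        using pos by (simp add: s_def)
      then have "2 * \<mu> / (s * (\<mu> + L)) + 2 / (c * (\<mu> + L)) = 2 * (\<mu> + L) / (s * (\<mu> + L))"
        by (simp only: add_divide_distrib [symmetric] distrib_left [symmetric])
      also have "\<dots> = 2 / s"
        using pos by (intro mult_divide_mult_cancel_right) simp
      finally show ?thesis by (simp add: \<rho>_def)
    qed
    then have "\<rho> * (norm G)\<^sup>2 + 2 / (c * (\<mu> + L)) * (norm G)\<^sup>2 = (2 / s - \<alpha>) * (norm G)\<^sup>2"
      by (simp only: distrib_right [symmetric])
    ultimately show ?thesis by linarith
  qed
  have decrease': "A / c\<^sup>2 * (norm d)\<^sup>2 + (2 / s - \<alpha>) * (norm u')\<^sup>2 \<le> 2 / c * (G \<bullet> d)"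
    using decrease mult_left_mono [OF u2, of "2 / s - \<alpha>"] \<open>\<alpha> \<le> 2 / s\<close> by linarith

  define W where "W = (norm (u' - u))\<^sup>2"
  have W_eq: "W = (norm u')\<^sup>2 - 2 * (u' \<bullet> u) + (norm u)\<^sup>2"
    unfolding W_def power2_norm_eq_inner by (simp add: inner_diff_left inner_diff_right inner_commute)
  have W_le: "W \<le> 2 * (norm u')\<^sup>2 + 2 * (norm u)\<^sup>2"
    using norm_add_square_weighted [of 1 u' "- u"] by (simp add: W_def)
  have balance: "(norm q')\<^sup>2 = (norm q)\<^sup>2 - (norm u)\<^sup>2 + W - 2 / c * (G \<bullet> d)"
  proof -
    have "(norm q)\<^sup>2 = (norm q')\<^sup>2 - 2 * (u' \<bullet> q') + (norm u')\<^sup>2"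
      unfolding q' power2_norm_eq_inner
      by (simp add: inner_add_left inner_add_right inner_commute)
    moreover have "1 / c * (G \<bullet> d) = (norm u')\<^sup>2 - u' \<bullet> u - u' \<bullet> q'"
      using pos by (simp add: pairing inner_diff_right power2_norm_eq_inner)
    ultimately show ?thesis unfolding W_eq by simp
  qed
  have dual': "\<delta> * (norm q')\<^sup>2 \<le> A / c\<^sup>2 * (norm d)\<^sup>2 + B * W"
  proof -
    have "\<delta> / (c\<^sup>2 * l) * (c\<^sup>2 * l * (norm q')\<^sup>2) \<le>
        \<delta> / (c\<^sup>2 * l) * ((1 + \<gamma>) * (norm d)\<^sup>2 + (1 + 1 / \<gamma>) * (c\<^sup>2 * W))"
      using dual pos unfolding W_def by (intro mult_left_mono) simp_all
    also have "\<delta> / (c\<^sup>2 * l) * ((1 + \<gamma>) * (norm d)\<^sup>2 + (1 + 1 / \<gamma>) * (c\<^sup>2 * W)) =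
        A / c\<^sup>2 * (norm d)\<^sup>2 + B * W"
      using pos unfolding A_def B_def distrib_left [of "\<delta> / (c\<^sup>2 * l)"] by (simp add: mult_ac)
    finally show ?thesis using pos by simp
  qed
  have "(1 + \<delta>) * (norm q')\<^sup>2 \<le> (norm q)\<^sup>2 - (norm u)\<^sup>2 + (1 + B) * W - (2 / s - \<alpha>) * (norm u')\<^sup>2"
    using balance dual' decrease' unfolding distrib_right [of _ _ W] distrib_right [of _ _ "(norm q')\<^sup>2"]
    by linarith
  also have "(1 + B) * W \<le> (1 + B) * (2 * (norm u')\<^sup>2 + 2 * (norm u)\<^sup>2)"
    using W_le \<open>0 \<le> B\<close> by (intro mult_left_mono) simp_all
  finally have main: "(1 + \<delta>) * (norm q')\<^sup>2 \<le>
      (norm q)\<^sup>2 + (1 + 2 * B) * (norm u)\<^sup>2 + (2 + 2 * B - 2 / s + \<alpha>) * (norm u')\<^sup>2"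
    by (simp add: algebra_simps)
  \<comment> \<open>With the second term of the rate bound inserted, the coefficient is bounded by a product,
    and the third term decides the sign of its second factor.\<close>
  have "(2 + 2 * B - 2 / s + \<alpha>) + (1 + \<delta>) * (1 + 2 * B) \<le> (1 + \<delta>) * (2 * (B - (1 / s - 2)))"
    using \<alpha>_le by (simp add: algebra_simps add_divide_distrib)
  also have "\<dots> \<le> 0"
    using B_le pos by (intro mult_nonneg_nonpos) simp_all
  finally have "((2 + 2 * B - 2 / s + \<alpha>) + (1 + \<delta>) * (1 + 2 * B)) * (norm u')\<^sup>2 \<le> 0"
    by (intro mult_nonpos_nonneg) simp_all
  with main show ?thesis by (simp add: algebra_simps)
qed


section \<open>Linear convergence\<close>

lemma geometric_decay:
  fixes V :: "nat \<Rightarrow> real"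
  assumes "\<delta> > 0" and "\<And>k. (1 + \<delta>) * V (Suc k) \<le> V k"
  shows "V k \<le> V 0 / (1 + \<delta>) ^ k"
proof (induction k)
  case (Suc k)
  have "V (Suc k) \<le> V k / (1 + \<delta>)"
    using assms by (simp add: field_simps)
  also have "\<dots> \<le> (V 0 / (1 + \<delta>) ^ k) / (1 + \<delta>)"
    using Suc assms(1) by (intro divide_right_mono) simp_all
  finally show ?case by (simp add: mult.commute)
qed simp

lemma square_sum_three_le:
  fixes a b d :: real
  shows "(a + b + d)\<^sup>2 \<le> 3 * (a\<^sup>2 + b\<^sup>2 + d\<^sup>2)"
proof -
  have "0 \<le> (a - b)\<^sup>2 + (b - d)\<^sup>2 + (a - d)\<^sup>2" by simp
  then show ?thesis by (simp add: power2_eq_square algebra_simps)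
qed

text \<open>
  The vectors \<open>y\<close> are images under \<open>transpose U\<close> of the partial sums of the \<open>u j\<close>. Expressing \<open>x (Suc k)\<close>
  through the sum that already contains the new gradient turns the iteration into an implicit
  dual ascent step with a correction by the difference of two consecutive gradients.
\<close>

lemma mirror_extra_factored:
  fixes U :: "real ^ 'n ^ 'm" and x y :: "nat \<Rightarrow> real ^ 'p ^ 'n"
  assumes alg: "mirror_extra E (transpose U ** U) f r c x y"
    and comp: "compatible E (transpose U ** U)"
  defines "u \<equiv> \<lambda>k. U ** (\<chi> i. gradient (f i) (x k $ i))"
  shows "x (Suc k) = r - c *\<^sub>R (transpose U ** (\<Sum>j\<le>Suc k. u j)) + c *\<^sub>R (transpose U ** (u (Suc k) - u k))"
proof -
  let ?Lap = "transpose U ** U"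
  define g where "g k = (\<chi> i. gradient (f i) (x k $ i))" for k
  have "y (Suc k) = y k + transpose U ** u k" for k
  proof -
    have "(\<Sum>j \<in> neighbors E i \<union> {i}. ?Lap $ i $ j *\<^sub>R gradient (f j) (x k $ j)) =
        (\<Sum>j \<in> UNIV. ?Lap $ i $ j *\<^sub>R g k $ j)" for i
      using comp by (intro sum.mono_neutral_cong_left) (auto simp: compatible_def neighbors_def g_def)
    also have "(\<Sum>j \<in> UNIV. ?Lap $ i $ j *\<^sub>R g k $ j) = (?Lap ** g k) $ i" for i
      by (simp add: vec_eq_iff matrix_matrix_mult_def)
    finally have "y (Suc k) $ i = y k $ i + (?Lap ** g k) $ i" for i
      using alg by (simp add: mirror_extra_def)
    then show ?thesis by (simp add: vec_eq_iff u_def g_def matrix_mul_assoc)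
  qed
  moreover have "y 0 = 0" using alg by (simp add: mirror_extra_def vec_eq_iff)
  ultimately have y: "y k = transpose U ** (\<Sum>j<k. u j)" for k
    by (induction k) (simp_all add: matrix_add_ldistrib)
  have "x (Suc k) = r - (2 * c) *\<^sub>R y (Suc k) + c *\<^sub>R y k"
    using alg by (simp add: mirror_extra_def vec_eq_iff)
  moreover have "(2 * c) *\<^sub>R v = c *\<^sub>R v + c *\<^sub>R v" for v :: "real ^ 'p ^ 'n"
    by (simp add: scaleR_left_distrib [symmetric])
  moreover have "(\<Sum>j\<le>Suc k. u j) = (\<Sum>j<k. u j) + u k + u (Suc k)"
    by (simp add: lessThan_Suc_atMost [symmetric])
  ultimately show ?thesis
    by (simp only: y sum.lessThan_Suc matrix_add_ldistrib matrix_diff_ldistrib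
        scaleR_add_right scaleR_diff_right) simp
qed

text \<open>
  At the solution the gradients agree, \<open>U (G xs) = 0\<close>, and \<open>q\<close> is a dual
  solution. Subtracting these equations from the iteration gives the errors to which
  the Lyapunov inequality applies. The primal error is a combination of the dual error and two
  consecutive values of \<open>u\<close>, so it decays with the Lyapunov function \<open>V\<close>.
\<close>

lemma factored_iteration_rate:
  fixes U :: "real ^ 'n ^ 'm" and x :: "nat \<Rightarrow> real ^ 'p ^ 'n" and G :: "real ^ 'p ^ 'n \<Rightarrow> real ^ 'p ^ 'n"
  defines "l \<equiv> lambda_min_nonzero (transpose U ** U)"
  assumes inj: "inj ((*v) (transpose U))" and lmax: "lambda_max (transpose U ** U) \<le> 1"
    and iter: "\<And>k. x (Suc k) = r - c *\<^sub>R (transpose U ** (\<Sum>j\<le>Suc k. U ** G (x j)))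
      + c *\<^sub>R (transpose U ** (U ** G (x (Suc k)) - U ** G (x k)))"
    and consensus: "U ** G xs = 0" and dual_opt: "r - xs = c *\<^sub>R (transpose U ** q)"
    and lipschitz: "\<And>z. norm (G z - G xs) \<le> L * norm (z - xs)"
    and coercive: "\<And>z. (norm (G z - G xs))\<^sup>2 + \<mu> * L * (norm (z - xs))\<^sup>2 \<le>
      (\<mu> + L) * ((G z - G xs) \<bullet> (z - xs))"
    and pos: "\<mu> > 0" "L > 0" "c > 0" "\<gamma> > 0" "\<delta> > 0" and step: "2 * (c * L) < 1"
    and rate: "\<delta> \<le> rate_bound \<mu> L c l \<gamma>"
  shows "\<exists>C. \<forall>k. (norm (x (Suc k) - xs))\<^sup>2 \<le> C / (1 + \<delta>) ^ k"
proof -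
  have "l > 0" unfolding l_def by (rule lambda_min_nonzero_gram [OF inj])
  define B where "B = \<delta> * (1 + 1 / \<gamma>) / l"
  have "0 \<le> B" using pos \<open>l > 0\<close> by (simp add: B_def)
  define u where "u k = U ** G (x k)" for k
  define e where "e k = (\<Sum>j\<le>k. u j) - q" for k
  define V where "V k = (norm (e k))\<^sup>2 + (1 + 2 * B) * (norm (u k))\<^sup>2" for k
  have e_Suc: "e (Suc k) = e k + u (Suc k)" for k by (simp add: e_def)
  have error: "x (Suc k) - xs = - (c *\<^sub>R (transpose U ** e (Suc k))) + c *\<^sub>R (transpose U ** (u (Suc k) - u k))" for k
    using iter [of k] dual_opt unfolding u_def [symmetric] e_def matrix_diff_ldistrib
    by (simp add: algebra_simps)
  have V_step: "(1 + \<delta>) * V (Suc k) \<le> V k" for k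
    unfolding V_def B_def
  proof (rule lyapunov_step [where d = "x (Suc k) - xs" and G = "G (x (Suc k)) - G xs" and c = c and L = L and \<mu> = \<mu>])
    let ?D = "transpose U ** (u (Suc k) - u k)"
    have u_diff: "U ** (G (x (Suc k)) - G xs) = u (Suc k)"
      by (simp add: matrix_diff_ldistrib consensus u_def)
    have adj: "(G (x (Suc k)) - G xs) \<bullet> (transpose U ** Z) = u (Suc k) \<bullet> Z" for Z
      using matrix_mult_inner_adjoint [of U Z "G (x (Suc k)) - G xs"]
      unfolding u_diff by (simp add: inner_commute)
    show "(G (x (Suc k)) - G xs) \<bullet> (x (Suc k) - xs) =
        c * (u (Suc k) \<bullet> (u (Suc k) - u k) - u (Suc k) \<bullet> e (Suc k))"
      unfolding error by (simp only: inner_add_right inner_minus_right inner_scaleR_right adj) (simp add: algebra_simps)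
    show "norm (u (Suc k)) \<le> norm (G (x (Suc k)) - G xs)"
      using norm_mult_le [OF lmax, of "G (x (Suc k)) - G xs"] by (simp add: u_diff)
    have "c *\<^sub>R (transpose U ** e (Suc k)) = - (x (Suc k) - xs) + c *\<^sub>R ?D"
      unfolding error by simp
    then have "(norm (c *\<^sub>R (transpose U ** e (Suc k))))\<^sup>2 \<le>
        (1 + \<gamma>) * (norm (x (Suc k) - xs))\<^sup>2 + (1 + 1 / \<gamma>) * (norm (c *\<^sub>R ?D))\<^sup>2"
      using norm_add_square_weighted [OF \<open>\<gamma> > 0\<close>, of "- (x (Suc k) - xs)" "c *\<^sub>R ?D"]
      by (simp only: norm_minus_cancel)
    moreover have "c\<^sup>2 * l * (norm (e (Suc k)))\<^sup>2 \<le> (norm (c *\<^sub>R (transpose U ** e (Suc k))))\<^sup>2"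
      using mult_left_mono [OF lambda_min_nonzero_le_transpose_mult [OF inj, of "e (Suc k)"], of "c\<^sup>2"]
      by (simp add: l_def power_mult_distrib mult_ac)
    moreover have "(norm (c *\<^sub>R ?D))\<^sup>2 \<le> c\<^sup>2 * (norm (u (Suc k) - u k))\<^sup>2"
      using power_mono [OF norm_transpose_mult_le [OF lmax, of "u (Suc k) - u k"], of 2]
      by (simp add: power_mult_distrib mult_left_mono)
    then have "(1 + 1 / \<gamma>) * (norm (c *\<^sub>R ?D))\<^sup>2 \<le> (1 + 1 / \<gamma>) * (c\<^sup>2 * (norm (u (Suc k) - u k))\<^sup>2)"
      using \<open>\<gamma> > 0\<close> by (intro mult_left_mono) simp_all
    ultimately show "c\<^sup>2 * l * (norm (e (Suc k)))\<^sup>2 \<le>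
        (1 + \<gamma>) * (norm (x (Suc k) - xs))\<^sup>2 + (1 + 1 / \<gamma>) * (c\<^sup>2 * (norm (u (Suc k) - u k))\<^sup>2)"
      by linarith
  qed (use e_Suc lipschitz coercive pos \<open>l > 0\<close> step rate in auto)
  have decay: "V k \<le> V 0 / (1 + \<delta>) ^ k" for k
    by (rule geometric_decay [where V = V, OF \<open>\<delta> > 0\<close> V_step])
  have V_nonneg: "0 \<le> V k" for k using \<open>0 \<le> B\<close> by (simp add: V_def)
  have error_le: "(norm (x (Suc k) - xs))\<^sup>2 \<le> 6 * c\<^sup>2 * V k" for k
  proof -
    have "norm (x (Suc k) - xs) \<le>
        norm (c *\<^sub>R (transpose U ** e (Suc k))) + norm (c *\<^sub>R (transpose U ** (u (Suc k) - u k)))"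
      unfolding error by (metis norm_triangle_ineq norm_minus_cancel)
    also have "\<dots> \<le> c * norm (e (Suc k)) + c * norm (u (Suc k) - u k)"
      using norm_transpose_mult_le [OF lmax] \<open>c > 0\<close> by (intro add_mono) simp_all
    also have "\<dots> \<le> c * (norm (e (Suc k)) + norm (u (Suc k)) + norm (u k))"
      using norm_triangle_ineq4 [of "u (Suc k)" "u k"] \<open>c > 0\<close> by (simp flip: distrib_left)
    finally have "(norm (x (Suc k) - xs))\<^sup>2 \<le> (c * (norm (e (Suc k)) + norm (u (Suc k)) + norm (u k)))\<^sup>2"
      by (rule power_mono) simp
    also have "\<dots> \<le> c\<^sup>2 * (3 * ((norm (e (Suc k)))\<^sup>2 + (norm (u (Suc k)))\<^sup>2 + (norm (u k))\<^sup>2))"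
      unfolding power_mult_distrib by (intro mult_left_mono square_sum_three_le) simp
    also have "\<dots> \<le> c\<^sup>2 * (3 * (V (Suc k) + V k))"
    proof -
      have "(norm (u j))\<^sup>2 \<le> (1 + 2 * B) * (norm (u j))\<^sup>2" for j
        using \<open>0 \<le> B\<close> by (simp add: mult_le_cancel_right1)
      then have "(norm (e (Suc k)))\<^sup>2 + (norm (u (Suc k)))\<^sup>2 + (norm (u k))\<^sup>2 \<le> V (Suc k) + V k"
        unfolding V_def by (smt (verit) zero_le_power2)
      then show ?thesis by (intro mult_left_mono) simp_all
    qed
    also have "\<dots> \<le> c\<^sup>2 * (3 * (V k + V k))"
    proof -
      have "V (Suc k) \<le> (1 + \<delta>) * V (Suc k)"
        using V_nonneg [of "Suc k"] \<open>\<delta> > 0\<close> by (simp add: mult_le_cancel_right1)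
      then show ?thesis using V_step [of k] by (intro mult_left_mono add_right_mono) simp_all
    qed
    finally show ?thesis by simp
  qed
  have "(norm (x (Suc k) - xs))\<^sup>2 \<le> (6 * c\<^sup>2 * V 0) / (1 + \<delta>) ^ k" for k
    using error_le [of k] mult_left_mono [OF decay [of k], of "6 * c\<^sup>2"] by simp
  then show ?thesis by blast
qed

theorem theorem6:
  fixes E :: "'n::finite set set"
    and Lap :: "real ^ 'n ^ 'n"
    and U :: "real ^ 'n ^ 'm"
    and f :: "'n \<Rightarrow> real ^ 'p \<Rightarrow> real"
    and r :: "real ^ 'p ^ 'n"
    and \<mu>i Li :: "'n \<Rightarrow> real"
    and \<mu> L c :: real
    and x y :: "nat \<Rightarrow> real ^ 'p ^ 'n"
  assumes "simple_graph E"
    and "connected_graph E"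
    and "compatible E Lap"
    and "CARD('m) = CARD('n) - 1"
    and "Lap = transpose U ** U"
    and "rank U = CARD('m)"
    and "{v. U *v v = 0} = {a *s 1 |a. True}"
    and "\<And>i z. f i differentiable (at z)"
    and "\<And>i. (Li i)-lipschitz_on UNIV (gradient (f i))"
    and "\<And>i. \<mu>i i > 0"
    and "\<And>i. strongly_convex (\<mu>i i) (f i)"
    and "\<mu> = Min (range \<mu>i)"
    and "L = Max (range Li)"
    and "lambda_max Lap \<le> 1"
    and "c \<in> {0 <..< 1 / (2 * L)}"
    and "mirror_extra E Lap f r c x y"
  shows "\<exists>xs. optimal_solution f r xs \<and> (\<forall>z. optimal_solution f r z \<longrightarrow> z = xs) \<and>
    x \<longlonglongrightarrow> xs \<and>
    (\<exists>\<delta>>0. \<exists>\<gamma>>0. \<delta> \<le> rate_bound \<mu> L c (lambda_min_nonzero Lap) \<gamma>) \<and>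
    (\<forall>\<delta>>0. (\<exists>\<gamma>>0. \<delta> \<le> rate_bound \<mu> L c (lambda_min_nonzero Lap) \<gamma>) \<longrightarrow>
       (\<lambda>k. (norm (x (Suc k) - xs))\<^sup>2) \<in> O(\<lambda>k. 1 / (1 + \<delta>) ^ k))"
proof -
  define G where "G x = (\<chi> i. gradient (f i) (x $ i))" for x :: "real ^ 'p ^ 'n"
  define l where "l = lambda_min_nonzero Lap"
  note kernel = assms(7)
  have "c > 0" and c_less: "c < 1 / (2 * L)" using assms(15) by auto
  \<comment> \<open>The interval for \<open>c\<close> is empty for \<open>L < 0\<close>, and also for \<open>L = 0\<close>, where \<open>1 / (2 * L)\<close> is 0.\<close>
  have "L > 0"
  proof (rule ccontr)
    assume "\<not> L > 0"
    then have "1 / (2 * L) \<le> 0" by (simp add: divide_nonneg_nonpos)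
    with \<open>c > 0\<close> c_less show False by linarith
  qed
  have step: "2 * (c * L) < 1" using c_less \<open>L > 0\<close> by (simp add: field_simps)
  have Li_le: "Li i \<le> L" for i by (simp add: assms(13))
  have mu_le: "\<mu> \<le> \<mu>i i" for i by (simp add: assms(12))
  have "\<mu> > 0" using assms(10) by (simp add: assms(12))
  have inj: "inj ((*v) (transpose U))"
    unfolding full_rank_injective [symmetric] rank_transpose by (rule assms(6))
  have lmax: "lambda_max (transpose U ** U) \<le> 1" using assms(5,14) by simp
  have "l > 0" unfolding l_def assms(5) by (rule lambda_min_nonzero_gram [OF inj])

  have mono: "\<mu> * (norm (x - z))\<^sup>2 \<le> (G x - G z) \<bullet> (x - z)" for x z
    unfolding G_def by (rule stacked_gradient_strongly_monotone [OF assms(11) mu_le])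
  have lipschitz: "norm (G x - G z) \<le> L * norm (x - z)" for x z
    unfolding G_def by (rule stacked_gradient_lipschitz [OF assms(9) Li_le]) (use \<open>L > 0\<close> in simp)
  have upper: "(G x - G z) \<bullet> (x - z) \<le> L * (norm (x - z))\<^sup>2" for x z
  proof -
    have "(G x - G z) \<bullet> (x - z) \<le> norm (G x - G z) * norm (x - z)" by (rule norm_cauchy_schwarz)
    also have "\<dots> \<le> L * norm (x - z) * norm (x - z)"
      using lipschitz by (rule mult_right_mono) simp
    finally show ?thesis by (simp add: power2_eq_square)
  qed
  have grad: "GDERIV (\<lambda>x. \<Sum>i\<in>UNIV. f i (x $ i)) z :> G z" for z
    unfolding G_def by (rule GDERIV_sum_rows [OF assms(8)])
  have coercive: "(norm (G z - G w))\<^sup>2 + \<mu> * L * (norm (z - w))\<^sup>2 \<le> (\<mu> + L) * ((G z - G w) \<bullet> (z - w))" for z w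
    by (rule gradient_coercivity [OF grad mono upper])

  obtain xs where opt: "optimal_solution f r xs" and unique: "\<And>z. optimal_solution f r z \<Longrightarrow> z = xs"
    and feasible: "(\<Sum>i\<in>UNIV. xs $ i - r $ i) = 0" and rows: "\<And>i k. G xs $ i = G xs $ k"
    using optimal_solution_exists [where r = r, OF assms(8) mono [unfolded G_def] \<open>\<mu> > 0\<close>]
    unfolding G_def by blast
  have consensus: "U ** G xs = 0"
    using rows by (simp add: mult_eq_0_iff_rows_equal [OF kernel])
  have "(\<Sum>i\<in>UNIV. ((1 / c) *\<^sub>R (r - xs)) $ i) = 0"
    using feasible by (simp add: sum_subtractf flip: scaleR_sum_right)
  then obtain q where q: "(1 / c) *\<^sub>R (r - xs) = transpose U ** q"
    by (rule zero_sum_in_range_transpose [OF kernel inj])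
  have dual_opt: "r - xs = c *\<^sub>R (transpose U ** q)"
    unfolding q [symmetric] using \<open>c > 0\<close> by simp
  have iter: "x (Suc k) = r - c *\<^sub>R (transpose U ** (\<Sum>j\<le>Suc k. U ** G (x j)))
      + c *\<^sub>R (transpose U ** (U ** G (x (Suc k)) - U ** G (x k)))" for k
    using assms(16,3) unfolding assms(5) G_def by (rule mirror_extra_factored)

  have bound: "\<exists>C. \<forall>k. (norm (x (Suc k) - xs))\<^sup>2 \<le> C / (1 + \<delta>) ^ k"
    if "\<delta> > 0" "\<gamma> > 0" "\<delta> \<le> rate_bound \<mu> L c l \<gamma>" for \<delta> \<gamma>
    using that unfolding l_def assms(5)
    by (intro factored_iteration_rate [OF inj lmax iter consensus dual_opt lipschitz coercive \<open>\<mu> > 0\<close> \<open>L > 0\<close> \<open>c > 0\<close>] step)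
  have big_o: "(\<lambda>k. (norm (x (Suc k) - xs))\<^sup>2) \<in> O(\<lambda>k. 1 / (1 + \<delta>) ^ k)"
    if rate: "\<delta> > 0" "\<gamma> > 0" "\<delta> \<le> rate_bound \<mu> L c l \<gamma>" for \<delta> \<gamma>
  proof -
    obtain C where C: "\<And>k. (norm (x (Suc k) - xs))\<^sup>2 \<le> C / (1 + \<delta>) ^ k"
      using bound [OF rate] by blast
    show ?thesis
      by (rule bigoI [of _ C]) (use C \<open>\<delta> > 0\<close> in simp)
  qed
  define \<delta>0 where "\<delta>0 = rate_bound \<mu> L c l 1"
  have "\<delta>0 > 0"
    unfolding \<delta>0_def using \<open>\<mu> > 0\<close> \<open>L > 0\<close> \<open>c > 0\<close> \<open>l > 0\<close> step by (intro rate_bound_pos) simp_all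
  have "x \<longlonglongrightarrow> xs"
  proof -
    obtain C where C: "\<And>k. (norm (x (Suc k) - xs))\<^sup>2 \<le> C / (1 + \<delta>0) ^ k"
      using bound [OF \<open>\<delta>0 > 0\<close>, of 1] by (auto simp: \<delta>0_def)
    have "(\<lambda>k. C / (1 + \<delta>0) ^ k) \<longlonglongrightarrow> 0"
      using \<open>\<delta>0 > 0\<close> by (intro LIMSEQ_divide_realpow_zero) simp
    then have "(\<lambda>k. (norm (x (Suc k) - xs))\<^sup>2) \<longlonglongrightarrow> 0"
      by (rule tendsto_sandwich [OF _ _ tendsto_const, rotated 2]) (use C in auto)
    then have "(\<lambda>k. sqrt ((norm (x (Suc k) - xs))\<^sup>2)) \<longlonglongrightarrow> sqrt 0"
      by (rule tendsto_real_sqrt)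
    then have "(\<lambda>k. x (Suc k)) \<longlonglongrightarrow> xs"
      by (simp add: LIM_zero_iff tendsto_norm_zero_iff)
    then show ?thesis by (rule LIMSEQ_imp_Suc)
  qed
  then show ?thesis
    using opt unique big_o \<open>\<delta>0 > 0\<close> unfolding \<delta>0_def l_def by (intro exI [of _ xs]) (blast intro: zero_less_one order_refl)
qed

end
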